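(* Let $A$ be an ordered graph and let $G$ be a member of the family $P\,\mathbb{y}\,A\,\mathbb{x}\,Q$ or of the family $P\,\mathbb{y}\,A\,\mathbb{x}\,R$, where $P$ is the ordered matching on $[10]$ with edges $\{1,3\},\{2,5\},\{4,9\},\{6,7\},\{8,10\}$, $Q$ is the ordered matching on $[10]$ with edges $\{1,3\},\{2,7\},\{4,5\},\{6,9\},\{8,10\}$, and $R$ is the ordered matching on $[8]$ with edges $\{1,3\},\{2,5\},\{4,7\},\{6,8\}$. If $G$ is not separable and $G$ has no vertex of degree zero and no vertex of degree two, then $sat_{<}(n,G)=O(1)$.
   Context: An ordered graph is a finite simple graph whose vertex set is linearly ordered (identified with $[m]$ with the natural order). An ordered graph $H$ contains an ordered graph $G$ if there is an injective order-preserving map $\varphi:V(G)\to V(H)$ with $\varphi(u)\varphi(v)\in E(H)$ for all $uv\in E(G)$; otherwise $H$ avoids $G$. $H$ saturates $G$ if $H$ avoids $G$ but adding any non-edge to $H$ yields a graph containing $G$. $sat_{<}(n,G)$ is the minimum number of edges of an ordered graph on $n$ vertices saturating $G$. Edges are written $uv$ with $u<v$. $G$ is separable if its edge set can be partitioned into two non-empty parts $E_1,E_2$ such that $u_1<v_1<u_2<v_2$ for all $u_1v_1\in E_1$, $u_2v_2\in E_2$. For ordered graphs $A,G_1,G_2$ on $n_0,n_1,n_2$ vertices, $G_1\,\mathbb{y}\,A\,\mathbb{x}\,G_2$ denotes the family of ordered graphs on vertex set $[n_1+n_0+n_2-2]$ obtained by choosing vertices $i,j$ with $n_1\le i,j\le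 n_1+n_0-1$ and taking the union of: a copy of $G_1$ placed (order-preservingly) on $\{1,\dots,n_1-1\}\cup\{i\}$, a copy of $A$ placed on $\{n_1,\dots,n_1+n_0-1\}$, and a copy of $G_2$ placed on $\{j\}\cup\{n_1+n_0,\dots,n_1+n_0+n_2-2\}$. (In the paper's notation $P=\Gamma_{\{0,0,1,0\}}$, $Q=\Gamma_{\{0,1,0,0\}}$, $R=\Gamma_4$.) *)

theory Defs
  imports Complex_Main "HOL-Library.Landau_Symbols"
begin

text \<open>An ordered graph with \<open>m\<close> vertices has vertex set \<open>{1..m}\<close>; an edge is stored as
  the pair of its endpoints with the smaller endpoint first.\<close>

datatype ograph = OGraph (nverts: nat) (edges: "(nat \<times> nat) set")

definition verts :: "ograph \<Rightarrow> nat set" where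
  "verts G = {1..nverts G}"

definition ordered_graph :: "ograph \<Rightarrow> bool" where
  "ordered_graph G \<longleftrightarrow> (\<forall>(u, v) \<in> edges G. u \<in> verts G \<and> v \<in> verts G \<and> u < v)"

definition degree :: "ograph \<Rightarrow> nat \<Rightarrow> nat" where
  "degree G w = card {(u, v). (u, v) \<in> edges G \<and> (u = w \<or> v = w)}"

definition contains :: "ograph \<Rightarrow> ograph \<Rightarrow> bool" where
  "contains H G \<longleftrightarrow>
    (\<exists>\<phi>. \<phi> ` verts G \<subseteq> verts H \<and> strict_mono_on (verts G) \<phi> \<and>
         (\<forall>(u, v) \<in> edges G. (\<phi> u, \<phi> v) \<in> edges H))"

definition saturates :: "ograph \<Rightarrow> ograph \<Rightarrow> bool" where
  "saturates H G \<longleftrightarrow>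
    \<not> contains H G \<and>
    (\<forall>u \<in> verts H. \<forall>v \<in> verts H. u < v \<and> (u, v) \<notin> edges H \<longrightarrow>
       contains (OGraph (nverts H) (insert (u, v) (edges H))) G)"

definition sat :: "nat \<Rightarrow> ograph \<Rightarrow> nat" where
  "sat n G = (LEAST k. \<exists>H. ordered_graph H \<and> nverts H = n \<and> saturates H G \<and> card (edges H) = k)"

definition separable :: "ograph \<Rightarrow> bool" where
  "separable G \<longleftrightarrow>
    (\<exists>E1 E2. E1 \<noteq> {} \<and> E2 \<noteq> {} \<and> E1 \<inter> E2 = {} \<and> E1 \<union> E2 = edges G \<and>
       (\<forall>(u1, v1) \<in> E1. \<forall>(u2, v2) \<in> E2. u1 < v1 \<and> v1 < u2 \<and> u2 < v2))"

text \<open>\<open>copy_on G S E\<close>: \<open>E\<close> is the edge set of the order-preserving copy of \<open>G\<close> on the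
  vertex set \<open>S\<close>. For finite \<open>S\<close> with \<open>nverts G\<close> elements the map \<open>f\<close> on \<open>verts G\<close>, and
  hence \<open>E\<close>, is unique (if \<open>G\<close> is an ordered graph).\<close>

definition copy_on :: "ograph \<Rightarrow> nat set \<Rightarrow> (nat \<times> nat) set \<Rightarrow> bool" where
  "copy_on G S E \<longleftrightarrow>
    (\<exists>f. strict_mono_on (verts G) f \<and> f ` verts G = S \<and> E = map_prod f f ` edges G)"

text \<open>In \<open>glue G1 A G2\<close> the last vertex of \<open>G1\<close> is identified with the vertex \<open>i\<close> of the
  copy of \<open>A\<close>, and the first vertex of \<open>G2\<close> with the vertex \<open>j\<close>. The upper bound
  \<open>n1 + n0 - 1\<close> is written as a strict bound \<open>n1 + n0\<close> to avoid truncated subtraction.\<close>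

definition glue :: "ograph \<Rightarrow> ograph \<Rightarrow> ograph \<Rightarrow> ograph set" where
  "glue G1 A G2 =
    (let n1 = nverts G1; n0 = nverts A; n2 = nverts G2 in
      {OGraph (n1 + n0 + n2 - 2) (E1 \<union> E0 \<union> E2) | i j E1 E0 E2.
         i \<in> {n1..<n1 + n0} \<and> j \<in> {n1..<n1 + n0} \<and>
         copy_on G1 ({1..n1 - 1} \<union> {i}) E1 \<and>
         copy_on A {n1..<n1 + n0} E0 \<and>
         copy_on G2 ({j} \<union> {n1 + n0..n1 + n0 + n2 - 2}) E2})"

definition graph_P :: ograph where
  "graph_P = OGraph 10 {(1, 3), (2, 5), (4, 9), (6, 7), (8, 10)}"

definition graph_Q :: ograph where
  "graph_Q = OGraph 10 {(1, 3), (2, 7), (4, 5), (6, 9), (8, 10)}"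

definition graph_R :: ograph where
  "graph_R = OGraph 8 {(1, 3), (2, 5), (4, 7), (6, 8)}"

text \<open>The minimum defining \<open>sat n G\<close> ranges over a non-empty set, and hence is attained,
  as soon as \<open>G\<close> has an edge.\<close>

lemma saturating_exists:
  assumes "edges G \<noteq> {}"
  shows "\<exists>H. ordered_graph H \<and> nverts H = n \<and> saturates H G"
proof -
  let ?U = "{1..n} \<times> {1..n}"
  let ?F = "{E. ordered_graph (OGraph n E) \<and> \<not> contains (OGraph n E) G}"
  have sub: "?F \<subseteq> Pow ?U"
    by (force simp: ordered_graph_def verts_def)
  have fin: "finite ?F"
    by (rule finite_subset[OF sub]) simp
  have "{} \<in> ?F"
    using assms by (auto simp: ordered_graph_def contains_def)
  then obtain E where E: "E \<in> ?F" and max: "\<And>E'. E' \<in> ?F \<Longrightarrow> E \<subseteq> E' \<Longrightarrow> E = E'"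
    using finite_has_maximal[OF fin] by blast
  have "contains (OGraph n (insert (u, v) E)) G"
    if "u \<in> {1..n}" "v \<in> {1..n}" "u < v" "(u, v) \<notin> E" for u v
    using max[of "insert (u, v) E"] E that by (auto simp: ordered_graph_def verts_def)
  then have "saturates (OGraph n E) G"
    using E by (auto simp: saturates_def verts_def)
  then show ?thesis
    using E by (metis (mono_tags, lifting) mem_Collect_eq ograph.sel(1))
qed

lemma sat_attained:
  assumes "edges G \<noteq> {}"
  shows "\<exists>H. ordered_graph H \<and> nverts H = n \<and> saturates H G \<and> card (edges H) = sat n G"
proof -
  have "\<exists>k H. ordered_graph H \<and> nverts H = n \<and> saturates H G \<and> card (edges H) = k"
    using saturating_exists[OF assms] by blast
  then show ?thesis
    unfolding sat_def by (rule LeastI_ex)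
qed

end

theory Submission
  imports Defs
begin

text \<open>
  Let \<open>m\<close> be the number of vertices of \<open>G\<close>. The host on \<open>n = m + D\<close> vertices consists of a copy
  of \<open>G\<close> without its last three vertices at the left end, a copy of \<open>G\<close> without its first three
  vertices at the right end, a long interval of isolated vertices between them, and five extra
  edges, three of which jump over the interval. Every edge at an isolated vertex completes a copy
  of \<open>G\<close>, in which it plays the role of \<open>{1, 3}\<close>, of \<open>{6, 7}\<close> or of the last edge of \<open>G\<close>.
  Extending the host to a saturated graph therefore adds edges only between the boundedly many
  other vertices.

  The host avoids \<open>G\<close>: an embedding \<open>\<phi>\<close> satisfies \<open>v \<le> \<phi> v \<le> v + D\<close>; every gap between vertices of
  \<open>G\<close> is crossed by an edge; and a host vertex of degree two can only lend one of its two edges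
  to the copy, as \<open>G\<close> has no vertex of degree two. Following the few host edges that cross the
  gaps near the interval, these three facts force the first vertex of the copy too far to the
  right, or the last one too far to the left.
\<close>

section \<open>Bounding the saturation number by a host\<close>

lemma contains_mono:
  assumes "contains (OGraph n E) G" "E \<subseteq> E'"
  shows "contains (OGraph n E') G"
proof -
  obtain \<phi> where "\<phi> ` {1..nverts G} \<subseteq> {1..n}" "strict_mono_on {1..nverts G} \<phi>"
    "\<forall>(u, v) \<in> edges G. (\<phi> u, \<phi> v) \<in> E"
    using assms(1) by (auto simp: contains_def verts_def)
  then show ?thesis
    using assms(2) unfolding contains_def verts_def by (intro exI[of _ \<phi>]) auto
qed

text \<open>A maximal \<open>G\<close>-avoiding extension of \<open>E0\<close> is saturated. It has
  no edge with an end outside \<open>S\<close>, since such an edge already completes a copy together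
  with \<open>E0\<close>.\<close>

lemma sat_le_host:
  assumes fin: "finite S"
    and ord: "ordered_graph (OGraph n E0)"
    and avoid: "\<not> contains (OGraph n E0) G"
    and sub: "E0 \<subseteq> S \<times> S"
    and create: "\<And>u v. \<lbrakk>1 \<le> u; u < v; v \<le> n; u \<notin> S \<or> v \<notin> S\<rbrakk>
      \<Longrightarrow> contains (OGraph n (insert (u, v) E0)) G"
  shows "sat n G \<le> card S * card S"
proof -
  define F where
    "F = {E. E0 \<subseteq> E \<and> ordered_graph (OGraph n E) \<and> \<not> contains (OGraph n E) G}"
  have "F \<subseteq> Pow ({1..n} \<times> {1..n})"
    by (force simp: F_def ordered_graph_def verts_def)
  then have fin_F: "finite F"
    by (rule finite_subset) simp
  have "F \<noteq> {}"
    using ord avoid by (auto simp: F_def)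
  from finite_has_maximal[OF fin_F this]
  obtain E where "E \<in> F" and max: "\<And>E'. E' \<in> F \<Longrightarrow> E \<subseteq> E' \<Longrightarrow> E = E'"
    by blast
  then have E: "E0 \<subseteq> E" "ordered_graph (OGraph n E)" "\<not> contains (OGraph n E) G"
    by (simp_all add: F_def)
  have "contains (OGraph n (insert (u, v) E)) G"
    if "u \<in> {1..n}" "v \<in> {1..n}" "u < v" "(u, v) \<notin> E" for u v
    using max[of "insert (u, v) E"] E that by (auto simp: F_def ordered_graph_def verts_def)
  then have "saturates (OGraph n E) G"
    using E by (auto simp: saturates_def verts_def)
  then have "sat n G \<le> card E"
    unfolding sat_def using E by (intro Least_le exI[of _ "OGraph n E"]) auto
  also have "E \<subseteq> S \<times> S"
  proof (rule subrelI, rule ccontr)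
    fix u v
    assume uv: "(u, v) \<in> E" "(u, v) \<notin> S \<times> S"
    then have "contains (OGraph n (insert (u, v) E0)) G"
      using E by (intro create) (auto simp: ordered_graph_def verts_def)
    then have "contains (OGraph n E) G"
      using E uv by (elim contains_mono) auto
    then show False
      using E by simp
  qed
  then have "card E \<le> card (S \<times> S)"
    using fin by (intro card_mono) auto
  finally show ?thesis
    by (simp add: card_cartesian_product)
qed

section \<open>The host graph\<close>

text \<open>
  The graph \<open>G\<close> has the vertices \<open>1, \<dots>, g + 4\<close>. The vertices \<open>1, \<dots>, 9\<close> come from \<open>P\<close>, and
  \<open>y, \<dots>, g + 4\<close> come from \<open>Q\<close> (where \<open>g = y + 4\<close>) or from \<open>R\<close> (where \<open>g = y + 2\<close>). The second
  disjunct of \<open>right_only\<close> only serves for the edge \<open>{4, 5}\<close> of \<open>Q\<close>.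
\<close>

locale glued_graph =
  fixes E :: "(nat \<times> nat) set" and g i j y :: nat
  assumes edge_range: "(a, b) \<in> E \<Longrightarrow> 1 \<le> a \<and> a < b \<and> b \<le> g + 4"
    and left_edges: "{(1, 3), (2, 5), (4, 9), (6, 7), (8, i)} \<subseteq> E"
    and left_only: "(a, b) \<in> E \<Longrightarrow> a \<le> 9 \<Longrightarrow> (a, b) \<in> {(1, 3), (2, 5), (4, 9), (6, 7), (8, i)}"
    and right_edges: "{(j, y + 1), (y, g + 1), (g, g + 3), (g + 2, g + 4)} \<subseteq> E"
    and right_only: "(a, b) \<in> E \<Longrightarrow> y \<le> b \<Longrightarrow>
      (a, b) \<in> {(j, y + 1), (y, g + 1), (g, g + 3), (g + 2, g + 4)} \<or> y + 1 < a \<and> b < g"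
    and i_range: "10 \<le> i" "i < y"
    and j_range: "10 \<le> j" "j < y"
    and y_less_g: "y + 2 \<le> g"
    and covered: "1 \<le> c \<Longrightarrow> c < g + 4 \<Longrightarrow> \<exists>a b. (a, b) \<in> E \<and> a \<le> c \<and> c < b"
    and degree_ne_2: "v \<in> {1..g + 4} \<Longrightarrow> card {e \<in> E. fst e = v \<or> snd e = v} \<noteq> 2"
begin

text \<open>
  The edge \<open>(g + 1, D + 5)\<close> plays the role of \<open>{2, 5}\<close> when only \<open>{1, 3}\<close> is missing, and
  \<open>(g, D + 4)\<close> that of \<open>{g, g + 3}\<close> when only the last edge is missing. The other three extra
  edges play the roles of \<open>{4, 9}\<close>, \<open>{2, 5}\<close> and \<open>{8, i}\<close> when only \<open>{6, 7}\<close> is missing.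
\<close>

definition host :: "nat \<Rightarrow> (nat \<times> nat) set" where
  "host D = {(a, b) \<in> E. b \<le> g + 1} \<union> {(a + D, b + D) | a b. (a, b) \<in> E \<and> 4 \<le> a} \<union>
    {(g, D + 4), (g + 1, D + 5), (y + 1, D + 6), (2, g), (D + 5, D + i)}"

text \<open>Edges near the ends of the long interval are listed one by one; the others are merely
  located. All later lists of host edges follow from these cases by arithmetic.\<close>

lemma host_cases:
  assumes "(a, b) \<in> host D"
  obtains "1 \<le> a" "a < b" "b < y"
  | "a = j" "b = y + 1" | "a = y" "b = g + 1" | "y + 1 < a" "a < b" "b < g"
  | "a = 2" "b = g" | "a = g" "b = D + 4" | "a = g + 1" "b = D + 5" | "a = y + 1" "b = D + 6"
  | "a = D + 4" "b = D + 9" | "a = D + 5" "b = D + i" | "a = D + 6" "b = D + 7"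
  | "a = D + 8" "b = D + i" | "D + 10 \<le> a" "a < b" "b \<le> D + (g + 4)"
proof -
  consider "(a, b) \<in> E" "b \<le> g + 1"
    | a' b' where "a = a' + D" "b = b' + D" "(a', b') \<in> E" "4 \<le> a'"
    | "(a, b) \<in> {(g, D + 4), (g + 1, D + 5), (y + 1, D + 6), (2, g), (D + 5, D + i)}"
    using assms unfolding host_def by (elim UnE) auto
  then show thesis
  proof cases
    case 1
    note range = edge_range[OF 1(1)]
    show thesis
    proof (cases "y \<le> b")
      case True
      then show thesis
        using right_only[OF 1(1) True] 1(2) range that(2-4) by (elim disjE) auto
    next
      case False
      then show thesis
        using range that(1) by simp
    qed
  next
    case 2
    note range = edge_range[OF 2(3)]
    show thesis
    proof (cases "a' \<le> 9")
      case True
      then have "(a', b') \<in> {(4, 9), (6, 7), (8, i)}"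
        using left_only[OF 2(3)] 2(4) by auto
      then show thesis
        using 2(1,2) that(9,11,12) by auto
    next
      case False
      then show thesis
        using 2(1,2) range that(13) by simp
    qed
  next
    case 3
    then consider "a = g" "b = D + 4" | "a = g + 1" "b = D + 5" | "a = y + 1" "b = D + 6"
      | "a = 2" "b = g" | "a = D + 5" "b = D + i"
      by auto
    then show thesis
      using that(5-8,10) by cases
  qed
qed

end

locale glued_graph_host = glued_graph +
  fixes D :: nat
  assumes D_large: "g + 4 \<le> D"
begin

section \<open>Host edges at and across the critical vertices\<close>

lemma host_range:
  "(a, b) \<in> host D \<Longrightarrow> 1 \<le> a \<and> a < b \<and> b \<le> D + (g + 4) \<and>
    (a \<le> g + 1 \<or> D + 4 \<le> a) \<and> (b \<le> g + 1 \<or> D + 4 \<le> b)"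
  by (erule host_cases) (use i_range j_range y_less_g D_large in auto)

lemma host_into_D4:
  "(a, b) \<in> host D \<Longrightarrow> b = D + 4 \<Longrightarrow> a = g"
  by (erule host_cases) (use i_range j_range y_less_g D_large in auto)

lemma host_into_D5:
  "(a, b) \<in> host D \<Longrightarrow> b = D + 5 \<Longrightarrow> a = g + 1"
  by (erule host_cases) (use i_range j_range y_less_g D_large in auto)

lemma host_from_y:
  "(a, b) \<in> host D \<Longrightarrow> a = y \<Longrightarrow> b = g + 1"
  by (erule host_cases) (use i_range j_range y_less_g D_large in auto)

lemma host_at_y1:
  "(a, b) \<in> host D \<Longrightarrow> a = y + 1 \<or> b = y + 1 \<Longrightarrow> (a, b) \<in> {(j, y + 1), (y + 1, D + 6)}"
  by (erule host_cases) (use i_range j_range y_less_g D_large in auto)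

lemma host_at_g1:
  "(a, b) \<in> host D \<Longrightarrow> a = g + 1 \<or> b = g + 1 \<Longrightarrow> (a, b) \<in> {(y, g + 1), (g + 1, D + 5)}"
  by (erule host_cases) (use i_range j_range y_less_g D_large in auto)

lemma host_at_D4:
  "(a, b) \<in> host D \<Longrightarrow> a = D + 4 \<or> b = D + 4 \<Longrightarrow> (a, b) \<in> {(g, D + 4), (D + 4, D + 9)}"
  by (erule host_cases) (use i_range j_range y_less_g D_large in auto)

lemma host_at_D5:
  "(a, b) \<in> host D \<Longrightarrow> a = D + 5 \<or> b = D + 5 \<Longrightarrow> (a, b) \<in> {(g + 1, D + 5), (D + 5, D + i)}"
  by (erule host_cases) (use i_range j_range y_less_g D_large in auto)

lemma host_over_y:
  "(a, b) \<in> host D \<Longrightarrow> a < y \<Longrightarrow> y \<le> b \<Longrightarrow> (a, b) \<in> {(2, g), (j, y + 1)}"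
  by (erule host_cases) (use i_range j_range y_less_g D_large in auto)

lemma host_over_y1:
  "(a, b) \<in> host D \<Longrightarrow> a < y + 1 \<Longrightarrow> y + 1 \<le> b \<Longrightarrow> (a, b) \<in> {(2, g), (j, y + 1), (y, g + 1)}"
  by (erule host_cases) (use i_range j_range y_less_g D_large in auto)

lemma host_around_g:
  "(a, b) \<in> host D \<Longrightarrow> 2 < a \<Longrightarrow> a < g \<Longrightarrow> g < b \<Longrightarrow> (a, b) \<in> {(y, g + 1), (y + 1, D + 6)}"
  by (erule host_cases) (use i_range j_range y_less_g D_large in auto)

lemma host_around_g1:
  "(a, b) \<in> host D \<Longrightarrow> a < g + 1 \<Longrightarrow> g + 1 < b \<Longrightarrow> (a, b) \<in> {(g, D + 4), (y + 1, D + 6)}"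
  by (erule host_cases) (use i_range j_range y_less_g D_large in auto)

lemma host_over_g1:
  "(a, b) \<in> host D \<Longrightarrow> a < g + 1 \<Longrightarrow> g + 1 \<le> b \<Longrightarrow> (a, b) \<in> {(y, g + 1), (g, D + 4), (y + 1, D + 6)}"
  by (erule host_cases) (use i_range j_range y_less_g D_large in auto)

lemma host_over_middle:
  "(a, b) \<in> host D \<Longrightarrow> a \<le> g + 1 \<Longrightarrow> g + 1 < b \<Longrightarrow> (a, b) \<in> {(g, D + 4), (g + 1, D + 5), (y + 1, D + 6)}"
  by (erule host_cases) (use i_range j_range y_less_g D_large in auto)

lemma host_over_D4:
  "(a, b) \<in> host D \<Longrightarrow> a \<le> D + 4 \<Longrightarrow> D + 4 < b \<Longrightarrow> (a, b) \<in> {(g + 1, D + 5), (y + 1, D + 6), (D + 4, D + 9)}"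
  by (erule host_cases) (use i_range j_range y_less_g D_large in auto)

lemma host_over_D5:
  "(a, b) \<in> host D \<Longrightarrow> a \<le> D + 5 \<Longrightarrow> D + 5 < b \<Longrightarrow> (a, b) \<in> {(y + 1, D + 6), (D + 4, D + 9), (D + 5, D + i)}"
  by (erule host_cases) (use i_range j_range y_less_g D_large in auto)

text \<open>From \<open>g + 1\<close> to \<open>D + 4\<close> only the two extreme vertices are not
  isolated, and they are not adjacent. Hence the image of \<open>{6, 7}\<close> cannot lie in this
  range.\<close>

lemma host_inside_middle:
  "(a, b) \<in> host D \<Longrightarrow> g < a \<Longrightarrow> b \<le> D + 4 \<Longrightarrow> False"
  by (erule host_cases) (use i_range j_range y_less_g D_large in auto)

section \<open>Copies completed by an edge at an isolated vertex\<close>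

definition outer :: "nat set" where
  "outer = {1..g + 1} \<union> {D + 4..D + (g + 4)}"

lemma host_EI_left: "(a, b) \<in> E \<Longrightarrow> b \<le> g + 1 \<Longrightarrow> (a, b) \<in> host D"
  by (simp add: host_def)

lemma host_EI_right: "(a, b) \<in> E \<Longrightarrow> 4 \<le> a \<Longrightarrow> (a + D, b + D) \<in> host D"
  unfolding host_def by blast

lemma host_extra_edges:
  "{(g, D + 4), (g + 1, D + 5), (y + 1, D + 6), (2, g), (D + 5, D + i)} \<subseteq> host D"
  unfolding host_def by blast

text \<open>Monotonicity is asked for consecutive vertices only, which suits piecewise
  shifts.\<close>

lemma containsI:
  assumes "\<And>a. 1 \<le> a \<Longrightarrow> a < g + 4 \<Longrightarrow> \<psi> a < \<psi> (a + 1)"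
    and "1 \<le> \<psi> 1" "\<psi> (g + 4) \<le> D + (g + 4)"
    and edges: "\<And>a b. (a, b) \<in> E \<Longrightarrow> (\<psi> a, \<psi> b) \<in> F"
  shows "contains (OGraph (D + (g + 4)) F) (OGraph (g + 4) E)"
proof -
  have mono: "\<psi> a < \<psi> b" if "a < b" "1 \<le> a" "b \<le> g + 4" for a b
    using that
  proof (induction b rule: less_Suc_induct[consumes 1, case_names step trans])
    case (step a)
    then show ?case using assms(1)[of a] by simp
  next
    case (trans a b c)
    then show ?case by simp
  qed
  have "\<psi> a \<in> {1..D + (g + 4)}" if "a \<in> {1..g + 4}" for a
  proof -
    have "\<psi> 1 \<le> \<psi> a"
      using mono[of 1 a] that by (cases "a = 1") auto
    moreover have "\<psi> a \<le> \<psi> (g + 4)"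
      using mono[of a "g + 4"] that by (cases "a = g + 4") auto
    ultimately show ?thesis
      using assms(2,3) by simp
  qed
  then show ?thesis
    unfolding contains_def verts_def
    by (intro exI[of _ \<psi>]) (auto intro!: strict_mono_onI mono edges)
qed

text \<open>The new edge serves as \<open>{1, 3}\<close>: the vertices \<open>1, 2, 3\<close> go to
  \<open>u, g + 1, x\<close>, and the rest is shifted by \<open>D\<close> into the right
  copy.\<close>

lemma role_first:
  assumes "1 \<le> u" "u < g + 1" "g + 1 < x" "x < D + 4" "(u, x) \<in> F" "host D \<subseteq> F"
  shows "contains (OGraph (D + (g + 4)) F) (OGraph (g + 4) E)"
proof (rule containsI)
  define \<psi> where
    "\<psi> a = (if a = 1 then u else if a = 2 then g + 1 else if a = 3 then x else a + D)" for a :: nat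
  show "\<psi> a < \<psi> (a + 1)" if "1 \<le> a" "a < g + 4" for a
    using assms that by (auto simp: \<psi>_def)
  show "1 \<le> \<psi> 1" "\<psi> (g + 4) \<le> D + (g + 4)"
    using assms by (auto simp: \<psi>_def)
  show "(\<psi> a, \<psi> b) \<in> F" if ab: "(a, b) \<in> E" for a b
  proof (cases "4 \<le> a")
    case True
    then show ?thesis
      using host_EI_right[OF ab] edge_range[OF ab] assms(6) by (auto simp: \<psi>_def)
  next
    case False
    then have "(a, b) = (1, 3) \<or> (a, b) = (2, 5)"
      using left_only[OF ab] by auto
    then show ?thesis
      using host_extra_edges assms(5,6) by (auto simp: \<psi>_def add.commute)
  qed
qed

text \<open>The new edge serves as \<open>{6, 7}\<close>. Vertex \<open>5\<close> goes to
  \<open>g\<close> and \<open>8\<close> to \<open>D + 5\<close>, so \<open>6\<close> and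
  \<open>7\<close> may go anywhere from \<open>g + 1\<close> to \<open>D + 4\<close>, ends included.
  \<open>{1, 3}\<close> stays in the left copy, \<open>{2, 5}\<close>, \<open>{4, 9}\<close> and
  \<open>{8, i}\<close> become extra edges, and all later edges go to the right copy.\<close>

lemma role_short:
  assumes "g + 1 \<le> x" "x < w" "w \<le> D + 4" "(x, w) \<in> F" "host D \<subseteq> F"
  shows "contains (OGraph (D + (g + 4)) F) (OGraph (g + 4) E)"
proof (rule containsI)
  define \<psi> where
    "\<psi> a = (if a \<le> 3 then a else if a = 4 then y + 1 else if a = 5 then g else if a = 6 then x
      else if a = 7 then w else if a = 8 then D + 5 else if a = 9 then D + 6 else a + D)" for a :: nat
  show "\<psi> a < \<psi> (a + 1)" if "1 \<le> a" "a < g + 4" for a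
    using assms that y_less_g i_range by (auto simp: \<psi>_def)
  show "1 \<le> \<psi> 1" "\<psi> (g + 4) \<le> D + (g + 4)"
    using assms y_less_g i_range by (auto simp: \<psi>_def)
  show "(\<psi> a, \<psi> b) \<in> F" if ab: "(a, b) \<in> E" for a b
  proof (cases "10 \<le> a")
    case True
    then show ?thesis
      using host_EI_right[OF ab] edge_range[OF ab] assms(5) by (auto simp: \<psi>_def)
  next
    case False
    then consider "a = 1" "b = 3" | "a = 2" "b = 5" | "a = 4" "b = 9" | "a = 6" "b = 7"
      | "a = 8" "b = i"
      using left_only[OF ab] by auto
    then show ?thesis
    proof cases
      case 1
      have "(1, 3) \<in> host D"
        using left_edges y_less_g i_range by (intro host_EI_left) auto
      then show ?thesis
        using 1 assms(5) by (auto simp: \<psi>_def)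
    qed (use host_extra_edges i_range assms(4,5) in \<open>auto simp: \<psi>_def add.commute\<close>)
  qed
qed

text \<open>The new edge serves as \<open>{g + 2, g + 4}\<close>. The vertices up to
  \<open>g + 1\<close> stay in the left copy, and \<open>g + 3\<close> goes to \<open>D + 4\<close>,
  where the extra edge from \<open>g\<close> ends.\<close>

lemma role_last:
  assumes "g + 1 < x" "x < D + 4" "D + 4 < w" "w \<le> D + (g + 4)" "(x, w) \<in> F" "host D \<subseteq> F"
  shows "contains (OGraph (D + (g + 4)) F) (OGraph (g + 4) E)"
proof (rule containsI)
  define \<psi> where
    "\<psi> a = (if a \<le> g + 1 then a else if a = g + 2 then x else if a = g + 3 then D + 4 else w)"
    for a :: nat
  show "\<psi> a < \<psi> (a + 1)" if "1 \<le> a" "a < g + 4" for a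
    using assms that by (auto simp: \<psi>_def)
  show "1 \<le> \<psi> 1" "\<psi> (g + 4) \<le> D + (g + 4)"
    using assms by (auto simp: \<psi>_def)
  show "(\<psi> a, \<psi> b) \<in> F" if ab: "(a, b) \<in> E" for a b
  proof (cases "b \<le> g + 1")
    case True
    then show ?thesis
      using host_EI_left[OF ab] edge_range[OF ab] assms(6) by (auto simp: \<psi>_def)
  next
    case False
    then have "(a, b) = (g, g + 3) \<or> (a, b) = (g + 2, g + 4)"
      using right_only[OF ab] y_less_g by auto
    then show ?thesis
      using host_extra_edges assms(5,6) by (auto simp: \<psi>_def)
  qed
qed

lemma host_creates:
  assumes "1 \<le> u" "u < v" "v \<le> D + (g + 4)" "u \<notin> outer \<or> v \<notin> outer"
  shows "contains (OGraph (D + (g + 4)) (insert (u, v) (host D))) (OGraph (g + 4) E)"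
proof -
  \<comment> \<open>One end is isolated, hence strictly between \<open>g + 1\<close> and
    \<open>D + 4\<close>; the other lies before, within or beyond this range.\<close>
  consider "u < g + 1" "g + 1 < v" "v < D + 4" | "g + 1 \<le> u" "v \<le> D + 4"
    | "g + 1 < u" "u < D + 4" "D + 4 < v"
    using assms unfolding outer_def by force
  then show ?thesis
  proof cases
    case 1
    then show ?thesis using assms by (intro role_first[of u v]) auto
  next
    case 2
    then show ?thesis using assms by (intro role_short[of u v]) auto
  next
    case 3
    then show ?thesis using assms by (intro role_last[of u v]) auto
  qed
qed

end

section \<open>The host avoids the graph\<close>

locale glued_graph_embedding = glued_graph_host +
  fixes \<phi> :: "nat \<Rightarrow> nat"
  assumes \<phi>_range: "v \<in> {1..g + 4} \<Longrightarrow> \<phi> v \<in> {1..D + (g + 4)}"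
    and \<phi>_mono: "strict_mono_on {1..g + 4} \<phi>"
    and \<phi>_edge: "(a, b) \<in> E \<Longrightarrow> (\<phi> a, \<phi> b) \<in> host D"
begin

section \<open>General constraints on an embedding\<close>

definition used :: "(nat \<times> nat) set" where
  "used = map_prod \<phi> \<phi> ` E"

lemma used_host: "(a, b) \<in> used \<Longrightarrow> (a, b) \<in> host D"
  by (auto simp: used_def \<phi>_edge)

lemma usedI: "(a, b) \<in> E \<Longrightarrow> (\<phi> a, \<phi> b) \<in> used"
  by (force simp: used_def)

lemma usedE:
  assumes "(a, b) \<in> used"
  obtains u v where "(u, v) \<in> E" "\<phi> u = a" "\<phi> v = b" "u \<in> {1..g + 4}" "v \<in> {1..g + 4}"
proof -
  from assms obtain u v where "(u, v) \<in> E" "\<phi> u = a" "\<phi> v = b"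
    by (auto simp: used_def)
  then show thesis
    using edge_range[of u v] that by auto
qed

lemma \<phi>_less_iff: "u \<in> {1..g + 4} \<Longrightarrow> v \<in> {1..g + 4} \<Longrightarrow> \<phi> u < \<phi> v \<longleftrightarrow> u < v"
  using \<phi>_mono by (rule strict_mono_on_less)

lemma \<phi>_inj: "inj_on \<phi> {1..g + 4}"
  using \<phi>_mono by (rule strict_mono_on_imp_inj_on)

lemma \<phi>_ge: "v \<in> {1..g + 4} \<Longrightarrow> v \<le> \<phi> v"
proof (induction v)
  case (Suc v)
  show ?case
  proof (cases "v = 0")
    case True
    then show ?thesis using \<phi>_range[of 1] by simp
  next
    case False
    then show ?thesis using Suc \<phi>_less_iff[of v "Suc v"] by auto
  qed
qed simp

lemma \<phi>_le:
  assumes "v \<in> {1..g + 4}"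
  shows "\<phi> v \<le> v + D"
proof -
  have "v \<le> g + 4" "1 \<le> v"
    using assms by auto
  then show ?thesis
  proof (induction v rule: inc_induct)
    case base
    then show ?case using \<phi>_range[of "g + 4"] by simp
  next
    case (step v)
    then show ?case using \<phi>_less_iff[of v "Suc v"] by auto
  qed
qed

text \<open>Let \<open>v\<close> be the last vertex mapped to at most \<open>c\<close>. Some edge of
  \<open>G\<close> crosses the gap after \<open>v\<close>, and its image crosses the gap after
  \<open>c\<close>, whether or not \<open>c\<close> is in the image of
  \<open>\<phi>\<close>.\<close>

lemma gap_crossed:
  assumes "u \<in> {1..g + 4}" "w \<in> {1..g + 4}" "\<phi> u \<le> c" "c < \<phi> w"
  shows "\<exists>a b. (a, b) \<in> used \<and> a \<le> c \<and> c < b"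
proof -
  define V where "V = {v \<in> {1..g + 4}. \<phi> v \<le> c}"
  define v where "v = Max V"
  have V: "finite V" "V \<noteq> {}"
    using assms by (auto simp: V_def)
  then have v: "v \<in> {1..g + 4}" "\<phi> v \<le> c"
    using Max_in[OF V] by (auto simp: V_def v_def)
  have "v < w"
    using \<phi>_less_iff[of v w] v assms by simp
  then obtain a b where ab: "(a, b) \<in> E" "a \<le> v" "v < b"
    using covered[of v] v assms(2) by auto
  have range: "a \<in> {1..g + 4}" "b \<in> {1..g + 4}"
    using edge_range[OF ab(1)] by auto
  have "b \<notin> V"
    using Max_ge[OF V(1), of b] ab(3) by (auto simp: v_def)
  then have "c < \<phi> b"
    using range by (auto simp: V_def)
  moreover have "\<phi> a \<le> c"
    using \<phi>_less_iff[of a v] ab(2) v range by (cases "a = v") auto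
  ultimately show ?thesis
    using usedI[OF ab(1)] by blast
qed

text \<open>Otherwise an edge of the copy would cross the gap between \<open>\<phi> v - 1\<close>
  and \<open>\<phi> v\<close>.\<close>

lemma first_vertex:
  assumes "v \<in> {1..g + 4}" "\<And>a b. (a, b) \<in> used \<Longrightarrow> a < \<phi> v \<Longrightarrow> \<phi> v \<le> b \<Longrightarrow> False"
  shows "v = 1"
proof (rule ccontr)
  assume "v \<noteq> 1"
  then have "\<phi> 1 < \<phi> v"
    using \<phi>_less_iff[of 1 v] assms(1) by auto
  then have "\<exists>a b. (a, b) \<in> used \<and> a \<le> \<phi> v - 1 \<and> \<phi> v - 1 < b"
    using assms(1) by (intro gap_crossed[of 1 v]) auto
  then obtain a b where "(a, b) \<in> used" "a \<le> \<phi> v - 1" "\<phi> v - 1 < b"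
    by blast
  then show False
    using assms(2)[of a b] \<open>\<phi> 1 < \<phi> v\<close> by linarith
qed

lemma last_vertex:
  assumes "v \<in> {1..g + 4}" "\<And>a b. (a, b) \<in> used \<Longrightarrow> a \<le> \<phi> v \<Longrightarrow> \<phi> v < b \<Longrightarrow> False"
  shows "v = g + 4"
proof (rule ccontr)
  assume "v \<noteq> g + 4"
  then have "\<phi> v < \<phi> (g + 4)"
    using \<phi>_less_iff[of v "g + 4"] assms(1) by auto
  then show False
    using gap_crossed[of v "g + 4" "\<phi> v"] assms by auto
qed

text \<open>As \<open>x\<close> has no other host edges, using both would give the preimage of
  \<open>x\<close> degree exactly two in \<open>G\<close>.\<close>

lemma not_both_used:
  assumes at_x: "\<And>a b. (a, b) \<in> host D \<Longrightarrow> a = x \<or> b = x \<Longrightarrow> (a, b) \<in> {e1, e2}"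
    and e1: "e1 \<in> used" "fst e1 = x \<or> snd e1 = x"
    and e2: "e2 \<in> used" "fst e2 = x \<or> snd e2 = x"
    and ne: "e1 \<noteq> e2"
  shows False
proof -
  obtain d1 d2 where d: "d1 \<in> E" "d2 \<in> E" "e1 = map_prod \<phi> \<phi> d1" "e2 = map_prod \<phi> \<phi> d2"
    using e1(1) e2(1) by (auto simp: used_def)
  have ends: "fst d \<in> {1..g + 4}" "snd d \<in> {1..g + 4}" if "d \<in> E" for d
    using edge_range[of "fst d" "snd d"] that by auto
  obtain v where v: "v \<in> {1..g + 4}" "\<phi> v = x"
    using d(1,3) ends[OF d(1)] e1(2) by (auto simp: map_prod_def split_beta)
  have at_v: "(fst d = v \<or> snd d = v) \<longleftrightarrow> (\<phi> (fst d) = x \<or> \<phi> (snd d) = x)" if "d \<in> E" for d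
    using ends[OF that] v \<phi>_inj by (auto dest: inj_onD)
  have inj: "d = d'" if "d \<in> E" "d' \<in> E" "map_prod \<phi> \<phi> d = map_prod \<phi> \<phi> d'" for d d'
    using that ends[OF that(1)] ends[OF that(2)] \<phi>_inj
    by (auto simp: map_prod_def split_beta prod_eq_iff dest: inj_onD)
  have "{d \<in> E. fst d = v \<or> snd d = v} = {d1, d2}"
  proof (intro equalityI subsetI)
    fix d assume "d \<in> {d \<in> E. fst d = v \<or> snd d = v}"
    then have d': "d \<in> E" "\<phi> (fst d) = x \<or> \<phi> (snd d) = x"
      using at_v[of d] by simp_all
    then have "map_prod \<phi> \<phi> d \<in> {e1, e2}"
      using at_x[of "\<phi> (fst d)" "\<phi> (snd d)"] \<phi>_edge[of "fst d" "snd d"]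
      by (simp add: map_prod_def split_beta)
    then show "d \<in> {d1, d2}"
      using d(3,4) inj[OF d'(1) d(1)] inj[OF d'(1) d(2)] by auto
  next
    fix d assume "d \<in> {d1, d2}"
    then have "d \<in> E" "\<phi> (fst d) = x \<or> \<phi> (snd d) = x"
      using d e1(2) e2(2) by (auto simp: map_prod_def split_beta)
    then show "d \<in> {d \<in> E. fst d = v \<or> snd d = v}"
      using at_v[of d] by simp
  qed
  moreover have "d1 \<noteq> d2"
    using ne d by auto
  ultimately have "card {d \<in> E. fst d = v \<or> snd d = v} = 2"
    by simp
  then show False
    using degree_ne_2[OF v(1)] by contradiction
qed

section \<open>Ruling out every embedding\<close>

lemma left_used: "(\<phi> 1, \<phi> 3) \<in> used" "(\<phi> 2, \<phi> 5) \<in> used" "(\<phi> 4, \<phi> 9) \<in> used" "(\<phi> 6, \<phi> 7) \<in> used"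
  and last_used: "(\<phi> (g + 2), \<phi> (g + 4)) \<in> used"
  using left_edges right_edges by (auto intro: usedI)

lemma mono_left: "u < v \<Longrightarrow> 1 \<le> u \<Longrightarrow> v \<le> 9 \<Longrightarrow> \<phi> u < \<phi> v"
  using \<phi>_less_iff[of u v] i_range y_less_g by auto

lemma small: "v \<le> 9 \<Longrightarrow> 1 \<le> v \<Longrightarrow> v \<in> {1..g + 4}"
  using i_range y_less_g by auto

text \<open>The vertex mapped to \<open>2\<close> is \<open>1\<close> or \<open>2\<close>, so
  \<open>(2, g)\<close> is the image of \<open>{1, 3}\<close> or \<open>{2, 5}\<close>. Then the
  image of \<open>{2, 5}\<close> or \<open>{4, 9}\<close>, respectively, has to pass over
  \<open>g\<close>, and only two host edges are available for this.\<close>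

lemma y1_D6_2_g_not_both_used:
  assumes y1: "(y + 1, D + 6) \<in> used" and "(2, g) \<in> used"
  shows False
proof -
  obtain x where x: "\<phi> x = y + 1" "x \<in> {1..g + 4}"
    using y1 by (rule usedE)
  \<comment> \<open>Consecutive vertices cannot skip \<open>y + 1\<close>, which is in the image of
    \<open>\<phi>\<close>.\<close>
  have between: False if "\<phi> v < y + 1" "y + 1 < \<phi> (v + 1)" "1 \<le> v" "v \<le> 8" for v
    using that x \<phi>_less_iff[OF small x(2), of v] \<phi>_less_iff[OF x(2) small, of "v + 1"] by auto
  obtain z w where zw: "(z, w) \<in> E" "\<phi> z = 2" "\<phi> w = g" "z \<in> {1..g + 4}"
    using assms(2) by (rule usedE)
  then have "z \<le> 2"
    using \<phi>_ge by force
  then consider "z = 1" "w = 3" | "z = 2" "w = 5"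
    using left_only[OF zw(1)] by auto
  then show False
  proof cases
    case 1
    then have "2 < \<phi> 2" "\<phi> 2 < g" "g < \<phi> 5"
      using zw mono_left[of 1 2] mono_left[of 2 3] mono_left[of 3 5] by auto
    then have "(\<phi> 2, \<phi> 5) \<in> {(y, g + 1), (y + 1, D + 6)}"
      using left_used(2) by (intro host_around_g used_host)
    \<comment> \<open>\<open>\<phi> 2 = y\<close> would skip \<open>y + 1\<close> on the way to
      \<open>\<phi> 3 = g\<close>, while \<open>\<phi> 5 = D + 6\<close> exceeds the bound
      \<open>5 + D\<close>.\<close>
    then show False
      using \<phi>_le[of 5] small[of 5] between[of 2] 1 zw y_less_g by auto
  next
    case 2
    then have "2 < \<phi> 4" "\<phi> 4 < g" "g < \<phi> 9"
      using zw mono_left[of 2 4] mono_left[of 4 5] mono_left[of 5 9] by auto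
    then have "(\<phi> 4, \<phi> 9) \<in> {(y, g + 1), (y + 1, D + 6)}"
      using left_used(3) by (intro host_around_g used_host)
    then have "\<phi> 9 = D + 6"
      using between[of 4] 2 zw y_less_g by auto
    \<comment> \<open>As \<open>\<phi> 5 = g\<close>, \<open>\<phi> 9 = D + 6\<close> and
      \<open>8\<close> comes after \<open>7\<close>, the image of \<open>{6, 7}\<close> would lie
      between \<open>g + 1\<close> and \<open>D + 4\<close>.\<close>
    then show False
      using host_inside_middle[OF used_host[OF left_used(4)]] 2 zw
        mono_left[of 5 6] mono_left[of 7 8] mono_left[of 8 9] by simp
  qed
qed

lemma y1_D6_not_used: "(y + 1, D + 6) \<notin> used"
proof
  assume y1: "(y + 1, D + 6) \<in> used"
  obtain x where x: "\<phi> x = y + 1" "x \<in> {1..g + 4}"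
    using y1 by (rule usedE)
  have no_2: "(2, g) \<notin> used"
    using y1_D6_2_g_not_both_used[OF y1] by blast
  have no_j: "(j, y + 1) \<notin> used"
    using not_both_used[OF host_at_y1] y1 j_range by auto
  show False
  proof (cases "(y, g + 1) \<in> used")
    case True
    then obtain z where z: "\<phi> z = y" "z \<in> {1..g + 4}"
      by (rule usedE)
    have "z = 1"
    proof (rule first_vertex[OF z(2)])
      fix a b assume "(a, b) \<in> used" "a < \<phi> z" "\<phi> z \<le> b"
      then show False
        using host_over_y[OF used_host, of a b] z(1) no_2 no_j by auto
    qed
    then have "\<phi> 3 = g + 1"
      using host_from_y[OF used_host[OF left_used(1)]] z by simp
    then have "(\<phi> 2, \<phi> 5) \<in> {(g, D + 4), (y + 1, D + 6)}"
      using left_used(2) mono_left[of 2 3] mono_left[of 3 5]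
      by (intro host_around_g1 used_host) auto
    then have "\<phi> 2 = g"
      using \<phi>_le[of 5] small[of 5] by auto
    \<comment> \<open>Again \<open>y + 1\<close> is in the image but would be skipped, now between
      \<open>1\<close> and \<open>2\<close>.\<close>
    then have "\<phi> 1 < \<phi> x" "\<phi> x < \<phi> 2"
      using z x \<open>z = 1\<close> y_less_g by auto
    then show False
      using \<phi>_less_iff[of 1 x] \<phi>_less_iff[of x 2] x small[of 1] small[of 2] by auto
  next
    case False
    have "x = 1"
    proof (rule first_vertex[OF x(2)])
      fix a b assume "(a, b) \<in> used" "a < \<phi> x" "\<phi> x \<le> b"
      then show False
        using host_over_y1[OF used_host, of a b] x(1) no_2 no_j False by auto
    qed
    then have "\<phi> 3 = D + 6"
      using host_at_y1[OF used_host[OF left_used(1)]] x j_range by auto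
    then show False
      using \<phi>_le[of 3] small[of 3] by simp
  qed
qed

lemma no_embedding: False
proof -
  \<comment> \<open>\<open>\<phi> 1\<close> is not isolated, and \<open>\<phi> 1 \<le> D + 1\<close>
    keeps it out of the right end.\<close>
  have "\<phi> 1 \<le> g + 1"
    using host_range[OF used_host[OF left_used(1)]] \<phi>_le[of 1] by auto
  moreover have "g + 1 < \<phi> (g + 4)"
    using \<phi>_ge[of "g + 4"] by simp
  ultimately obtain a b where "(a, b) \<in> used" "a \<le> g + 1" "g + 1 < b"
    using gap_crossed[of 1 "g + 4" "g + 1"] by auto
  then have middle: "(g, D + 4) \<in> used \<or> (g + 1, D + 5) \<in> used"
    using host_over_middle[OF used_host] y1_D6_not_used by blast
  have no_9: "(D + 4, D + 9) \<notin> used" if "(g, D + 4) \<in> used"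
    using not_both_used[OF host_at_D4] that D_large by auto
  show False
  proof (cases "(g + 1, D + 5) \<in> used")
    case g1: True
    have no_y: "(y, g + 1) \<notin> used"
      using not_both_used[OF host_at_g1] g1 y_less_g by auto
    have no_i: "(D + 5, D + i) \<notin> used"
      using not_both_used[OF host_at_D5] g1 D_large by auto
    obtain u v where uv: "\<phi> u = g + 1" "\<phi> v = D + 5" "u \<in> {1..g + 4}" "v \<in> {1..g + 4}"
      using g1 by (rule usedE)
    show False
    proof (cases "(g, D + 4) \<in> used")
      case True
      have "v = g + 4"
      proof (rule last_vertex[OF uv(4)])
        fix a b assume "(a, b) \<in> used" "a \<le> \<phi> v" "\<phi> v < b"
        then show False
          using host_over_D5[OF used_host, of a b] uv(2) no_9[OF True] no_i y1_D6_not_used by auto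
      qed
      then have "\<phi> (g + 2) = g + 1"
        using host_into_D5[OF used_host[OF last_used]] uv by simp
      then show False
        using \<phi>_ge[of "g + 2"] by simp
    next
      case False
      have "u = 1"
      proof (rule first_vertex[OF uv(3)])
        fix a b assume "(a, b) \<in> used" "a < \<phi> u" "\<phi> u \<le> b"
        then show False
          using host_over_g1[OF used_host, of a b] uv(1) False no_y y1_D6_not_used by auto
      qed
      then have "\<phi> 3 = D + 5"
        using host_at_g1[OF used_host[OF left_used(1)]] uv y_less_g by auto
      then show False
        using \<phi>_le[of 3] small[of 3] by simp
    qed
  next
    case False
    then have g: "(g, D + 4) \<in> used"
      using middle by simp
    obtain v where v: "\<phi> v = D + 4" "v \<in> {1..g + 4}"
      using g by (rule usedE)
    have "v = g + 4"
    proof (rule last_vertex[OF v(2)])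
      fix a b assume "(a, b) \<in> used" "a \<le> \<phi> v" "\<phi> v < b"
      then show False
        using host_over_D4[OF used_host, of a b] v(1) False no_9[OF g] y1_D6_not_used by auto
    qed
    then have "\<phi> (g + 2) = g"
      using host_into_D4[OF used_host[OF last_used]] v by simp
    then show False
      using \<phi>_ge[of "g + 2"] by simp
  qed
qed

end

section \<open>The bound on the saturation number\<close>

context glued_graph_host
begin

lemma host_avoids: "\<not> contains (OGraph (D + (g + 4)) (host D)) (OGraph (g + 4) E)"
proof
  assume "contains (OGraph (D + (g + 4)) (host D)) (OGraph (g + 4) E)"
  then obtain \<phi> where "\<phi> ` {1..g + 4} \<subseteq> {1..D + (g + 4)}" "strict_mono_on {1..g + 4} \<phi>"
    "\<forall>(u, v) \<in> E. (\<phi> u, \<phi> v) \<in> host D"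
    by (auto simp: contains_def verts_def)
  then interpret glued_graph_embedding E g i j y D \<phi>
    by unfold_locales (auto simp: image_subset_iff)
  show False
    by (rule no_embedding)
qed

lemma sat_le: "sat (D + (g + 4)) (OGraph (g + 4) E) \<le> (2 * g + 2) * (2 * g + 2)"
proof -
  have "sat (D + (g + 4)) (OGraph (g + 4) E) \<le> card outer * card outer"
  proof (rule sat_le_host)
    show "ordered_graph (OGraph (D + (g + 4)) (host D))"
      by (auto simp: ordered_graph_def verts_def dest: host_range)
    show "host D \<subseteq> outer \<times> outer"
      by (auto simp: outer_def dest: host_range)
  qed (use host_avoids host_creates in \<open>auto simp: outer_def\<close>)
  \<comment> \<open>\<open>outer\<close> omits exactly the isolated interval, so its size does not
    depend on \<open>D\<close>.\<close>
  also have "card outer = 2 * g + 2"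
    unfolding outer_def using D_large by (subst card_Un_disjoint) auto
  finally show ?thesis .
qed

end

lemma (in glued_graph) sat_bounded: "(\<lambda>n. real (sat n (OGraph (g + 4) E))) \<in> O(\<lambda>n. 1)"
proof (rule bigoI)
  let ?c = "(2 * g + 2) * (2 * g + 2)"
  show "\<forall>\<^sub>F n in sequentially. norm (real (sat n (OGraph (g + 4) E))) \<le> real ?c * norm (1 :: real)"
  proof (rule eventually_sequentiallyI)
    fix n :: nat
    assume n: "2 * (g + 4) \<le> n"
    \<comment> \<open>This choice of \<open>D\<close> gives a host on exactly \<open>n\<close>
      vertices.\<close>
    interpret glued_graph_host E g i j y "n - (g + 4)"
      using n by unfold_locales simp
    have "sat n (OGraph (g + 4) E) \<le> ?c"
      using sat_le n by simp
    then show "norm (real (sat n (OGraph (g + 4) E))) \<le> real ?c * norm (1 :: real)"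
      by (simp del: of_nat_mult)
  qed
qed

section \<open>Members of the two families\<close>

text \<open>A strictly increasing map lists its image in sorted order without repetition, and a
  finite set has only one such list.\<close>

lemma strict_mono_on_unique:
  fixes f f' :: "nat \<Rightarrow> nat"
  assumes "strict_mono_on {1..n} f" "strict_mono_on {1..n} f'" "f ` {1..n} = f' ` {1..n}"
    and "v \<in> {1..n}"
  shows "f v = f' v"
proof -
  have sorted: "sorted (map h [1..<Suc n]) \<and> distinct (map h [1..<Suc n])"
    if "strict_mono_on {1..n} h" for h :: "nat \<Rightarrow> nat"
    using that strict_mono_on_imp_inj_on[OF that] strict_mono_on_imp_mono_on[OF that]
    by (auto simp: distinct_map sorted_map sorted_wrt_iff_nth_less mono_on_def
        atLeastLessThanSuc_atLeastAtMost simp del: upt_Suc)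
  have "map f [1..<Suc n] = map f' [1..<Suc n]"
    using sorted[OF assms(1)] sorted[OF assms(2)] assms(3)
    by (intro sorted_distinct_set_unique) (auto simp: atLeastLessThanSuc_atLeastAtMost simp del: upt_Suc)
  then show ?thesis
    using assms(4) by (simp add: map_eq_conv atLeastLessThanSuc_atLeastAtMost del: upt_Suc)
qed

lemma copy_on_eq:
  assumes "copy_on G S E" "ordered_graph G"
    and "strict_mono_on (verts G) f" "f ` verts G = S"
  shows "E = map_prod f f ` edges G"
proof -
  obtain f' where f': "strict_mono_on (verts G) f'" "f' ` verts G = S" "E = map_prod f' f' ` edges G"
    using assms(1) by (auto simp: copy_on_def)
  have "f' v = f v" if "v \<in> verts G" for v
    using strict_mono_on_unique[of "nverts G" f' f v] f' assms(3,4) that by (simp add: verts_def)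
  then show ?thesis
    unfolding f'(3) using assms(2) by (intro image_cong) (auto simp: ordered_graph_def)
qed

lemma copy_on_edges:
  assumes "copy_on G S E" "ordered_graph G" "(a, b) \<in> E"
  shows "a \<in> S \<and> b \<in> S \<and> a < b"
  using assms by (fastforce simp: copy_on_def ordered_graph_def strict_mono_on_def)

lemma graph_P_copy:
  assumes "copy_on graph_P ({1..9} \<union> {i}) E" "10 \<le> i"
  shows "E = {(1, 3), (2, 5), (4, 9), (6, 7), (8, i)}"
proof -
  let ?f = "\<lambda>v. if v = 10 then i else v"
  have "E = map_prod ?f ?f ` edges graph_P"
  proof (rule copy_on_eq[OF assms(1)])
    show "ordered_graph graph_P"
      by (simp add: graph_P_def ordered_graph_def verts_def)
    show "strict_mono_on (verts graph_P) ?f"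
      using assms(2) by (auto intro!: strict_mono_onI simp: graph_P_def verts_def)
    show "?f ` verts graph_P = {1..9} \<union> {i}"
      by (force simp: graph_P_def verts_def)
  qed
  then show ?thesis
    by (simp add: graph_P_def)
qed

text \<open>This serves \<open>Q\<close> with \<open>k = 8\<close> and \<open>R\<close> with
  \<open>k = 6\<close>. Vertex \<open>2\<close> goes to \<open>y\<close>, whence the shift by
  \<open>y - 2\<close>.\<close>

lemma right_copy_map:
  fixes j y k :: nat
  assumes "j < y"
  defines "f \<equiv> \<lambda>v. if v = 1 then j else v + y - 2"
  shows "strict_mono_on {1..k + 2} f" "f ` {1..k + 2} = {j} \<union> {y..y + k}"
proof -
  show "strict_mono_on {1..k + 2} f"
    using assms by (auto intro!: strict_mono_onI simp: f_def)
  show "f ` {1..k + 2} = {j} \<union> {y..y + k}"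
  proof (intro equalityI subsetI)
    fix x assume "x \<in> {j} \<union> {y..y + k}"
    then consider "x = j" | "x \<in> {y..y + k}"
      by blast
    then show "x \<in> f ` {1..k + 2}"
    proof cases
      case 1
      then show ?thesis by (intro image_eqI[of _ _ 1]) (auto simp: f_def)
    next
      case 2
      then show ?thesis by (intro image_eqI[of _ _ "x + 2 - y"]) (auto simp: f_def)
    qed
  qed (auto simp: f_def split: if_splits)
qed

lemma graph_Q_copy:
  assumes "copy_on graph_Q ({j} \<union> {y..y + 8}) E" "j < y"
  shows "E = {(j, y + 1), (y, y + 5), (y + 2, y + 3), (y + 4, y + 7), (y + 6, y + 8)}"
proof -
  let ?f = "\<lambda>v. if v = 1 then j else v + y - 2"
  have "E = map_prod ?f ?f ` edges graph_Q"
    using right_copy_map[OF assms(2), of 8]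
    by (intro copy_on_eq[OF assms(1)]) (auto simp: graph_Q_def ordered_graph_def verts_def)
  then show ?thesis
    by (simp add: graph_Q_def add.commute)
qed

lemma graph_R_copy:
  assumes "copy_on graph_R ({j} \<union> {y..y + 6}) E" "j < y"
  shows "E = {(j, y + 1), (y, y + 3), (y + 2, y + 5), (y + 4, y + 6)}"
proof -
  let ?f = "\<lambda>v. if v = 1 then j else v + y - 2"
  have "E = map_prod ?f ?f ` edges graph_R"
    using right_copy_map[OF assms(2), of 6]
    by (intro copy_on_eq[OF assms(1)]) (auto simp: graph_R_def ordered_graph_def verts_def)
  then show ?thesis
    by (simp add: graph_R_def add.commute)
qed

text \<open>If no edge crosses the gap after \<open>c\<close>, the edges starting at or before
  \<open>c\<close> and those starting later separate \<open>G\<close>. Both classes are non-empty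
  because \<open>c\<close> and \<open>c + 1\<close> each have an edge.\<close>

lemma gap_covered:
  assumes "ordered_graph G" "\<not> separable G"
    and "\<And>v. v \<in> verts G \<Longrightarrow> degree G v \<noteq> 0"
    and "1 \<le> c" "c < nverts G"
  shows "\<exists>a b. (a, b) \<in> edges G \<and> a \<le> c \<and> c < b"
proof (rule ccontr)
  assume contr: "\<not> ?thesis"
  have no: "b \<le> c" if "(a, b) \<in> edges G" "a \<le> c" for a b
    using contr that by (meson not_le)
  define E1 where "E1 = {e \<in> edges G. fst e \<le> c}"
  define E2 where "E2 = {e \<in> edges G. c < fst e}"
  have ord: "a < b" if "(a, b) \<in> edges G" for a b
    using assms(1) that by (auto simp: ordered_graph_def)
  have edge: "\<exists>a b. (a, b) \<in> edges G \<and> (a = v \<or> b = v)" if "v \<in> verts G" for v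
  proof (rule ccontr)
    assume "\<not> ?thesis"
    then have "{(a, b). (a, b) \<in> edges G \<and> (a = v \<or> b = v)} = {}"
      by auto
    then show False
      using assms(3)[OF that] unfolding degree_def by (metis card.empty)
  qed
  obtain a b where ab: "(a, b) \<in> edges G" "a = c \<or> b = c"
    using edge[of c] assms(4,5) by (auto simp: verts_def)
  then have "a \<le> c"
    using ord[OF ab(1)] by auto
  then have "E1 \<noteq> {}"
    using ab(1) by (force simp: E1_def)
  moreover obtain a' b' where ab': "(a', b') \<in> edges G" "a' = Suc c \<or> b' = Suc c"
    using edge[of "Suc c"] assms(4,5) by (auto simp: verts_def)
  then have "c < a'"
    using no[OF ab'(1)] by (cases "a' \<le> c") auto
  then have "E2 \<noteq> {}"
    using ab'(1) by (force simp: E2_def)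
  moreover have "E1 \<inter> E2 = {}" "E1 \<union> E2 = edges G"
    by (auto simp: E1_def E2_def)
  moreover have "u1 < v1 \<and> v1 < u2 \<and> u2 < v2" if "(u1, v1) \<in> E1" "(u2, v2) \<in> E2" for u1 v1 u2 v2
    using that no[of u1 v1] ord[of u1 v1] ord[of u2 v2] by (simp add: E1_def E2_def)
  ultimately have "separable G"
    unfolding separable_def by (intro exI[of _ E1] exI[of _ E2]) auto
  then show False
    using assms(2) by simp
qed

text \<open>Common form of the two families. \<open>E0\<close> holds the edges from
  \<open>A\<close>; \<open>E3\<close> is \<open>{(y + 2, y + 3)}\<close> with
  \<open>g = y + 4\<close> for \<open>Q\<close>, and empty with \<open>g = y + 2\<close> for
  \<open>R\<close>.\<close>

lemma sat_bounded_if_glued: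
  fixes g i j y :: nat
  assumes G: "G = OGraph (g + 4) ({(1, 3), (2, 5), (4, 9), (6, 7), (8, i)} \<union> E0 \<union>
      ({(j, y + 1), (y, g + 1), (g, g + 3), (g + 2, g + 4)} \<union> E3))"
    and E0: "\<And>a b. (a, b) \<in> E0 \<Longrightarrow> 10 \<le> a \<and> a < b \<and> b < y"
    and E3: "\<And>a b. (a, b) \<in> E3 \<Longrightarrow> y + 1 < a \<and> a < b \<and> b < g"
    and range: "10 \<le> i" "i < y" "10 \<le> j" "j < y" "y + 2 \<le> g"
    and "\<not> separable G"
    and "\<And>v. v \<in> verts G \<Longrightarrow> degree G v \<noteq> 0"
    and "\<And>v. v \<in> verts G \<Longrightarrow> degree G v \<noteq> 2"
  shows "(\<lambda>n. real (sat n G)) \<in> O(\<lambda>n. 1)"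
proof -
  have n: "nverts G = g + 4"
    by (simp add: G)
  have subset: "{(1, 3), (2, 5), (4, 9), (6, 7), (8, i)} \<subseteq> edges G"
    "{(j, y + 1), (y, g + 1), (g, g + 3), (g + 2, g + 4)} \<subseteq> edges G"
    unfolding G by auto
  have cases: thesis
    if "(a, b) \<in> edges G"
      and "(a, b) \<in> {(1, 3), (2, 5), (4, 9), (6, 7), (8, i)} \<Longrightarrow> thesis"
      and "10 \<le> a \<Longrightarrow> a < b \<Longrightarrow> b < y \<Longrightarrow> thesis"
      and "(a, b) \<in> {(j, y + 1), (y, g + 1), (g, g + 3), (g + 2, g + 4)} \<Longrightarrow> thesis"
      and "y + 1 < a \<Longrightarrow> a < b \<Longrightarrow> b < g \<Longrightarrow> thesis" for a b thesis
    using that E0[of a b] E3[of a b] unfolding G ograph.sel by blast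
  have edge: "1 \<le> a \<and> a < b \<and> b \<le> g + 4" if "(a, b) \<in> edges G" for a b
    using that by (rule cases) (use range in auto)
  have ord: "ordered_graph G"
    unfolding ordered_graph_def verts_def n using edge by fastforce
  interpret glued_graph "edges G" g i j y
  proof
    show "\<exists>a b. (a, b) \<in> edges G \<and> a \<le> c \<and> c < b" if "1 \<le> c" "c < g + 4" for c
      using that by (intro gap_covered ord assms) (simp_all add: n)
    show "card {e \<in> edges G. fst e = v \<or> snd e = v} \<noteq> 2" if "v \<in> {1..g + 4}" for v
    proof -
      have "{e \<in> edges G. fst e = v \<or> snd e = v} = {(a, b). (a, b) \<in> edges G \<and> (a = v \<or> b = v)}"
        by auto
      moreover have "v \<in> verts G"
        using that by (simp add: verts_def n)
      ultimately show ?thesis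
        using assms(11)[of v] unfolding degree_def by metis
    qed
    show "(a, b) \<in> {(1, 3), (2, 5), (4, 9), (6, 7), (8, i)}" if "(a, b) \<in> edges G" "a \<le> 9" for a b
      using that(1) by (rule cases) (use that(2) range in auto)
    show "(a, b) \<in> {(j, y + 1), (y, g + 1), (g, g + 3), (g + 2, g + 4)} \<or> y + 1 < a \<and> b < g"
      if "(a, b) \<in> edges G" "y \<le> b" for a b
      using that(1) by (rule cases) (use that(2) range in auto)
  qed (use edge subset range in blast)+
  have "G = OGraph (g + 4) (edges G)"
    by (simp add: n[symmetric])
  then show ?thesis
    using sat_bounded by simp
qed

lemma glueE:
  assumes "G \<in> glue G1 A G2"
  obtains i j E1 E0 E2 where
    "G = OGraph (nverts G1 + nverts A + nverts G2 - 2) (E1 \<union> E0 \<union> E2)"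
    "i \<in> {nverts G1..<nverts G1 + nverts A}" "j \<in> {nverts G1..<nverts G1 + nverts A}"
    "copy_on G1 ({1..nverts G1 - 1} \<union> {i}) E1"
    "copy_on A {nverts G1..<nverts G1 + nverts A} E0"
    "copy_on G2 ({j} \<union> {nverts G1 + nverts A..nverts G1 + nverts A + nverts G2 - 2}) E2"
  using assms unfolding glue_def Let_def mem_Collect_eq by metis

theorem theorem5:
  fixes A G :: ograph
  assumes "ordered_graph A"
    and "G \<in> glue graph_P A graph_Q \<or> G \<in> glue graph_P A graph_R"
    and "\<not> separable G"
    and "\<And>v. v \<in> verts G \<Longrightarrow> degree G v \<noteq> 0"
    and "\<And>v. v \<in> verts G \<Longrightarrow> degree G v \<noteq> 2"
  shows "(\<lambda>n. real (sat n G)) \<in> O(\<lambda>n. 1)"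
  using assms(2)
proof
  define y where "y = 10 + nverts A"
  assume "G \<in> glue graph_P A graph_Q"
  then obtain i j E1 E0 E2 where "G = OGraph (y + 8) (E1 \<union> E0 \<union> E2)"
    "i \<in> {10..<y}" "j \<in> {10..<y}" "copy_on graph_P ({1..10 - 1} \<union> {i}) E1"
    "copy_on A {10..<y} E0" "copy_on graph_Q ({j} \<union> {y..y + 8}) E2"
    by (rule glueE) (simp add: graph_P_def graph_Q_def y_def)
  then have G: "G = OGraph (y + 8) (E1 \<union> E0 \<union> E2)"
    and ij: "10 \<le> i" "i < y" "10 \<le> j" "j < y"
    and E1: "copy_on graph_P ({1..9} \<union> {i}) E1"
    and E0: "copy_on A {10..<y} E0"
    and E2: "copy_on graph_Q ({j} \<union> {y..y + 8}) E2"
    by simp_all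
  \<comment> \<open>The image of the edge \<open>{4, 5}\<close> of \<open>Q\<close> is split off to
    become \<open>E3\<close>.\<close>
  have E2: "E2 = {(j, y + 1), (y, y + 5), (y + 4, y + 7), (y + 6, y + 8)} \<union> {(y + 2, y + 3)}"
    using graph_Q_copy[OF E2 ij(4)] by auto
  show ?thesis
  proof (rule sat_bounded_if_glued)
    show "G = OGraph (y + 4 + 4) ({(1, 3), (2, 5), (4, 9), (6, 7), (8, i)} \<union> E0 \<union>
        ({(j, y + 1), (y, y + 4 + 1), (y + 4, y + 4 + 3), (y + 4 + 2, y + 4 + 4)} \<union> {(y + 2, y + 3)}))"
      unfolding G graph_P_copy[OF E1 ij(1)] E2 by (simp add: numeral_eq_Suc)
    show "10 \<le> a \<and> a < b \<and> b < y" if "(a, b) \<in> E0" for a b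
      using copy_on_edges[OF E0 assms(1) that] by simp
  qed (use ij assms(3-5) in auto)
next
  define y where "y = 10 + nverts A"
  assume "G \<in> glue graph_P A graph_R"
  then obtain i j E1 E0 E2 where "G = OGraph (y + 6) (E1 \<union> E0 \<union> E2)"
    "i \<in> {10..<y}" "j \<in> {10..<y}" "copy_on graph_P ({1..10 - 1} \<union> {i}) E1"
    "copy_on A {10..<y} E0" "copy_on graph_R ({j} \<union> {y..y + 6}) E2"
    by (rule glueE) (simp add: graph_P_def graph_R_def y_def)
  then have G: "G = OGraph (y + 6) (E1 \<union> E0 \<union> E2)"
    and ij: "10 \<le> i" "i < y" "10 \<le> j" "j < y"
    and E1: "copy_on graph_P ({1..9} \<union> {i}) E1"
    and E0: "copy_on A {10..<y} E0"
    and E2: "copy_on graph_R ({j} \<union> {y..y + 6}) E2"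
    by simp_all
  have E2: "E2 = {(j, y + 1), (y, y + 3), (y + 2, y + 5), (y + 4, y + 6)} \<union> {}"
    using graph_R_copy[OF E2 ij(4)] by auto
  show ?thesis
  proof (rule sat_bounded_if_glued)
    show "G = OGraph (y + 2 + 4) ({(1, 3), (2, 5), (4, 9), (6, 7), (8, i)} \<union> E0 \<union>
        ({(j, y + 1), (y, y + 2 + 1), (y + 2, y + 2 + 3), (y + 2 + 2, y + 2 + 4)} \<union> {}))"
      unfolding G graph_P_copy[OF E1 ij(1)] E2 by (simp add: numeral_eq_Suc)
    show "10 \<le> a \<and> a < b \<and> b < y" if "(a, b) \<in> E0" for a b
      using copy_on_edges[OF E0 assms(1) that] by simp
  qed (use ij assms(3-5) in auto)
qed

end
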